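(* Let $\{b_n\}_{n\in\mathbb{N}}$ be an increasing sequence of positive numbers such that $\inf_{n>1}(b_n-b_{n-1})>0$. Then there is a comb domain $C$, that is, a domain of the form \[C=\{z\in\mathbb{C}:\mathrm{Re}\, z>-x_1\}\setminus\bigcup_{n\in\mathbb{N}\cup\{0\}}\{x_n+iy: y\in\mathbb{R},\ |y|\ge 1\}\] where $x_0=0$ and $\{x_n\}_{n\in\mathbb{N}}$ is a strictly increasing sequence of positive numbers with $\lim_{n\to+\infty}x_n=+\infty$ and $\inf_{n\in\mathbb{N}}(x_n-x_{n-1})>1$, such that, with $\alpha_n=x_n-x_{n-1}$, one has $\alpha_n\le e^{b_n}$ for every $n\in\mathbb{N}$, \[\liminf_{n\to+\infty}\frac{\log\alpha_n}{b_n-b_{n-1}}<+\infty,\] and ${\rm h}(C)<+\infty$.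
   Context: $\mathbb{N}=\{1,2,3,\dots\}$ and $\mathbb{D}$ is the open unit disk in $\mathbb{C}$. For $p>0$, the Hardy space $H^p(\mathbb{D})$ is the set of all holomorphic functions $f$ on $\mathbb{D}$ with $\sup_{0<r<1}\int_0^{2\pi}|f(re^{i\theta})|^p\,d\theta<+\infty$. If $D\ne\mathbb{C}$ is a simply connected domain and $f$ is a Riemann mapping (conformal bijection) from $\mathbb{D}$ onto $D$, the Hardy number of $D$ is ${\rm h}(D)=\sup\{p>0: f\in H^p(\mathbb{D})\}\in[1/2,+\infty]$; it does not depend on the choice of $f$. *)

theory Defs
  imports "HOL-Complex_Analysis.Complex_Analysis"
begin

definition hardy_space :: "real \<Rightarrow> (complex \<Rightarrow> complex) set" where
  "hardy_space p = {f. f holomorphic_on ball 0 1 \<and>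
     (SUP r\<in>{0<..<1::real}. \<integral>\<^sup>+\<theta>\<in>{0..2*pi}.
        ennreal (cmod (f (of_real r * exp (\<i> * of_real \<theta>))) powr p) \<partial>lborel) < \<infinity>}"

definition riemann_mapping :: "(complex \<Rightarrow> complex) \<Rightarrow> complex set \<Rightarrow> bool" where
  "riemann_mapping f D \<longleftrightarrow> f holomorphic_on ball 0 1 \<and> bij_betw f (ball 0 1) D"

text \<open>Meaningful only for a nonempty simply connected domain \<open>D\<close> other than the whole plane;
  the value is then the same for every Riemann mapping onto \<open>D\<close>.\<close>

definition hardy_number :: "complex set \<Rightarrow> ereal" where
  "hardy_number D =
     (let f = (SOME f. riemann_mapping f D) in Sup (ereal ` {p. p > 0 \<and> f \<in> hardy_space p}))"

text \<open>The sequence \<open>x\<close> starts with \<open>x 0 = 0\<close>. The infimum is taken in the reals; it is a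
  genuine one, since the differences are positive.\<close>

definition comb_domain :: "(nat \<Rightarrow> real) \<Rightarrow> complex set \<Rightarrow> bool" where
  "comb_domain x C \<longleftrightarrow>
     x 0 = 0 \<and> (\<forall>n\<ge>1. x n > 0) \<and> strict_mono_on {1..} x \<and>
     filterlim x at_top sequentially \<and>
     (INF n\<in>{1..}. x n - x (n - 1)) > 1 \<and>
     open C \<and> connected C \<and>
     C = {z. Re z > - x 1} - (\<Union>n. {Complex (x n) y |y. \<bar>y\<bar> \<ge> 1})"

end

theory Submission
  imports Defs "HOL-Real_Asymp.Real_Asymp"
begin

text \<open>
  All gaps are taken equal to \<open>a = exp (b 1)\<close>, except that \<open>exp (b n)\<close> is used whenever
  the sequence constructed so far is still below a fixed multiple of \<open>n\<close>. Both cases occur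
  infinitely often, since a linear function of slope greater than \<open>a\<close> outgrows gaps equal to \<open>a\<close>
  and is outgrown by \<open>exp (b n)\<close>. The gaps equal to \<open>a\<close> bound the lower limit.

  If \<open>g\<close> is the inverse of a Riemann mapping \<open>f\<close> in \<open>H\<^sup>p\<close> and \<open>N \<le> p\<close>, Cauchy's formula for
  \<open>f ^ N\<close> bounds \<open>\<bar>w\<bar> ^ N * (1 - \<bar>g w\<bar>)\<close> on the domain. At the middle \<open>w\<close> of a column of width
  \<open>exp (b n)\<close> which starts at a point of size \<open>O(n)\<close>, a chain of \<open>O(n)\<close> unit discs followed by one
  large disc shows, by Schwarz-Pick, that \<open>1 - \<bar>g w\<bar>\<close> is at least \<open>exp (- O(n)) * exp (- b n)\<close>,
  hence at least a fixed power of \<open>1 / \<bar>w\<bar>\<close>, because \<open>n = O(b n)\<close>. This bounds \<open>p\<close>.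
\<close>

section \<open>Harnack inequalities for holomorphic maps into the unit disc\<close>

text \<open>Schwarz's lemma is applied to \<open>g\<close> followed by the disc automorphism that
  sends \<open>g 0\<close> to 0. The squared form lets \<open>norm_one_minus_cnj_mult\<close> be
  substituted.\<close>

lemma Schwarz_Pick_disc:
  assumes "g holomorphic_on ball 0 1" "g ` ball 0 1 \<subseteq> ball 0 1" "cmod z < 1"
  shows "(cmod (g z - g 0))\<^sup>2 \<le> (cmod z)\<^sup>2 * (cmod (1 - cnj (g 0) * g z))\<^sup>2"
proof -
  have g: "cmod (g w) < 1" if "cmod w < 1" for w
    using assms(2) that by (metis image_subset_iff mem_ball_0)
  have a1: "cmod (g 0) < 1" by (simp add: g)
  define h where "h = Moebius_function 0 (g 0) \<circ> g"
  have "h holomorphic_on ball 0 1"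
    unfolding h_def
    by (rule holomorphic_on_compose_gen[OF assms(1) Moebius_function_holomorphic[OF a1] assms(2)])
  moreover have "h 0 = 0"
    by (simp add: h_def Moebius_function_eq_zero)
  moreover have "cmod (h w) < 1" if "cmod w < 1" for w
    using Moebius_function_norm_lt_1[OF a1 g[OF that]] by (simp add: h_def)
  ultimately have "cmod (h z) \<le> cmod z"
    using Schwarz_Lemma(1)[of h z] assms(3) by blast
  then have "cmod (g z - g 0) / cmod (1 - cnj (g 0) * g z) \<le> cmod z"
    by (simp add: h_def Moebius_function_simple norm_divide)
  moreover have "cmod (1 - cnj (g 0) * g z) > 0"
  proof -
    have "cmod (cnj (g 0) * g z) < 1"
      using norm_mult_less[of "cnj (g 0)" 1 "g z" 1] a1 g[OF assms(3)] by simp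
    then have "1 \<noteq> cnj (g 0) * g z"
      by (metis less_irrefl norm_one)
    then show ?thesis by simp
  qed
  ultimately have "cmod (g z - g 0) \<le> cmod z * cmod (1 - cnj (g 0) * g z)"
    by (simp add: divide_simps mult.commute split: if_splits)
  then show ?thesis
    by (metis norm_ge_zero power_mono power_mult_distrib)
qed

lemma norm_one_minus_cnj_mult:
  "(cmod (1 - cnj a * w))\<^sup>2 = (cmod (w - a))\<^sup>2 + (1 - (cmod w)\<^sup>2) * (1 - (cmod a)\<^sup>2)"
  unfolding cmod_power2 by (simp add: algebra_simps power2_eq_square)

text \<open>By Schwarz-Pick the moduli \<open>s\<close> and \<open>t\<close> of \<open>g z\<close>
  and \<open>g 0\<close> satisfy \<open>\<bar>s - t\<bar> \<le> r * (1 - s * t)\<close>, a bound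
  symmetric in \<open>s\<close> and \<open>t\<close>, so both inequalities follow from it.\<close>

lemma Harnack_disc:
  assumes "g holomorphic_on ball 0 1" "g ` ball 0 1 \<subseteq> ball 0 1" "cmod z < 1"
  shows "(1 - cmod (g 0)) * (1 - cmod z) \<le> (1 - cmod (g z)) * (1 + cmod z)"
    and "(1 - cmod (g z)) * (1 - cmod z) \<le> (1 - cmod (g 0)) * (1 + cmod z)"
proof -
  define s t r X Y where "s = cmod (g z)" "t = cmod (g 0)" "r = cmod z"
    "X = (cmod (g z - g 0))\<^sup>2" "Y = (1 - s\<^sup>2) * (1 - t\<^sup>2)"
  note defs = this
  have st: "0 \<le> s" "s < 1" "0 \<le> t" "t < 1" "0 \<le> r" "r < 1"
    using assms by (auto simp: defs image_subset_iff)
  have "X \<le> r\<^sup>2 * (X + Y)"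
    using Schwarz_Pick_disc[OF assms] norm_one_minus_cnj_mult[of "g 0" "g z"] by (simp add: defs)
  moreover have "(s - t)\<^sup>2 \<le> X"
    unfolding defs using power_mono[OF norm_triangle_ineq3[of "g z" "g 0"], of 2] by simp
  moreover have "1 - r\<^sup>2 \<ge> 0"
    using st by (simp add: power_le_one)
  ultimately have "(s - t)\<^sup>2 * (1 - r\<^sup>2) \<le> r\<^sup>2 * Y"
    using mult_right_mono[of "(s - t)\<^sup>2" X "1 - r\<^sup>2"] by (simp add: algebra_simps)
  \<comment> \<open>Since \<open>Y = (1 - s * t)\<^sup>2 - (s - t)\<^sup>2\<close>, the terms
    \<open>r\<^sup>2 * (s - t)\<^sup>2\<close> cancel.\<close>
  then have "(s - t)\<^sup>2 \<le> (r * (1 - s * t))\<^sup>2"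
    by (simp add: defs(5) power2_eq_square algebra_simps)
  moreover have "s * t \<le> 1"
    using st by (simp add: mult_le_one)
  ultimately have d: "\<bar>s - t\<bar> \<le> r * (1 - s * t)"
    using st by (metis abs_le_square_iff abs_of_nonneg diff_ge_0_iff_ge mult_nonneg_nonneg)
  \<comment> \<open>This says that \<open>1 - s * t\<close> is at most
    \<open>(1 - s) + (1 - t)\<close>, which makes the bound linear in \<open>1 - s\<close> and
    \<open>1 - t\<close>.\<close>
  have "0 \<le> (1 - s) * (1 - t)" using st by simp
  then have "r * (1 - s * t + s + t) \<le> r * 2"
    using st by (intro mult_left_mono) (simp_all add: algebra_simps)
  then show "(1 - cmod (g 0)) * (1 - cmod z) \<le> (1 - cmod (g z)) * (1 + cmod z)"
    and "(1 - cmod (g z)) * (1 - cmod z) \<le> (1 - cmod (g 0)) * (1 + cmod z)"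
    using d unfolding defs(1-3)[symmetric] by (simp_all add: algebra_simps abs_le_iff)
qed

text \<open>The first inequality serves the unit discs of the chain, which are left away from the
  centre; the second serves the large disc, which is entered near its boundary and left at its
  centre.\<close>

lemma Harnack_ball:
  assumes hol: "g holomorphic_on ball c R" and im: "g ` ball c R \<subseteq> ball 0 1" and w: "cmod (w - c) < R"
  shows "(1 - cmod (g c)) * (R - cmod (w - c)) \<le> (1 - cmod (g w)) * (R + cmod (w - c))"
    and "(1 - cmod (g w)) * (R - cmod (w - c)) \<le> (1 - cmod (g c)) * (R + cmod (w - c))"
proof -
  have R: "R > 0" using w norm_ge_zero order_le_less_trans by blast
  define h where "h = g \<circ> (\<lambda>z. c + of_real R * z)"
  have sub: "(\<lambda>z. c + of_real R * z) ` ball 0 1 \<subseteq> ball c R"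
    using R by (auto simp: dist_norm norm_mult)
  have 1: "h holomorphic_on ball 0 1"
    unfolding h_def by (rule holomorphic_on_compose_gen[OF _ hol sub]) (intro holomorphic_intros)
  have 2: "h ` ball 0 1 \<subseteq> ball 0 1"
    using sub im unfolding h_def by fastforce
  define z where "z = (w - c) / of_real R"
  have z: "cmod z = cmod (w - c) / R" using R by (simp add: z_def norm_divide)
  have 3: "cmod z < 1" using R w by (simp add: z)
  have eq: "h 0 = g c" "h z = g w" using R by (simp_all add: h_def z_def)
  have c: "1 - cmod z = (R - cmod (w - c)) / R" "1 + cmod z = (R + cmod (w - c)) / R"
    using R by (simp_all add: z field_simps)
  show "(1 - cmod (g c)) * (R - cmod (w - c)) \<le> (1 - cmod (g w)) * (R + cmod (w - c))"
    and "(1 - cmod (g w)) * (R - cmod (w - c)) \<le> (1 - cmod (g c)) * (R + cmod (w - c))"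
    using Harnack_disc[OF 1 2 3] R unfolding eq c by (simp_all add: divide_right_mono divide_le_cancel)
qed

section \<open>Growth of Hardy space functions and of inverse Riemann mappings\<close>

text \<open>An integer exponent keeps \<open>f ^ N\<close> holomorphic even where \<open>f\<close>
  vanishes. On the circle of integration \<open>N \<le> p\<close> gives that the \<open>N\<close>-th
  power of the modulus is at most 1 plus its \<open>p\<close>-th power, whose integral is bounded
  independently of the radius.\<close>

lemma hardy_space_growth:
  assumes f: "f \<in> hardy_space p" and N: "real N \<le> p"
  obtains M where "\<And>z. z \<in> ball 0 1 \<Longrightarrow> cmod (f z) ^ N * (1 - cmod z) \<le> M"
proof -
  have hol: "f holomorphic_on ball 0 1"
    using f by (simp add: hardy_space_def)
  define S where "S = (SUP r\<in>{0<..<1::real}. \<integral>\<^sup>+\<theta>\<in>{0..2*pi}.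
        ennreal (cmod (f (of_real r * exp (\<i> * of_real \<theta>))) powr p) \<partial>lborel)"
  have "S < \<infinity>" using f by (simp add: hardy_space_def S_def)
  then obtain A where A: "S = ennreal A" "A \<ge> 0"
    by (cases S) auto
  show ?thesis
  proof
    fix z :: complex assume "z \<in> ball 0 1"
    then have z: "cmod z < 1" by simp
    \<comment> \<open>Halfway between \<open>cmod z\<close> and 1, so the circle stays at distance
      at least \<open>(1 - cmod z) / 2\<close> from \<open>z\<close>.\<close>
    define r where "r = (1 + cmod z) / 2"
    have r: "0 < r" "r < 1" "cmod z < r"
      using z by (auto simp: r_def add_pos_nonneg)
    define I where "I = (\<lambda>t. cmod (f (of_real r * cis t)) powr p)"
    have sub: "of_real r * cis t \<in> ball 0 1" for t
      using r by (simp add: norm_mult)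
    have cont_f: "continuous_on {0..2*pi} (\<lambda>t. f (of_real r * cis t))"
      by (rule continuous_on_compose2[OF holomorphic_on_imp_continuous_on[OF hol]])
         (use sub in \<open>auto intro!: continuous_intros\<close>)
    have p: "p \<ge> 0" using N by linarith
    show "cmod (f z) ^ N * (1 - cmod z) \<le> 2 * (2 * pi + A) / (2 * pi)"
    \<comment> \<open>As \<open>0 powr 0 = 0\<close>, the function \<open>I\<close> may be
      discontinuous at zeros of \<open>f\<close> when \<open>p = 0\<close>; then
      \<open>N = 0\<close> and the claim is immediate.\<close>
    proof (cases "p = 0")
      case True
      then have "N = 0" using N by simp
      moreover have "1 - cmod z \<le> 2 * (2 * pi + A) / (2 * pi)"
        using A pi_gt_zero by (simp add: field_simps)
      ultimately show ?thesis by simp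
    next
      case False
      then have p: "p > 0" using p by simp
      have cont_I: "continuous_on {0..2*pi} I"
        unfolding I_def using p
        by (intro continuous_on_powr' continuous_on_norm cont_f continuous_on_const) auto
      then have "(I has_integral integral {0..2*pi} I) {0..2*pi}"
        using integrable_continuous_real by blast
      then have "(\<integral>\<^sup>+t. ennreal (I t) * indicator {0..2*pi} t \<partial>lborel) = ennreal (integral {0..2*pi} I)"
        by (intro nn_integral_has_integral_lebesgue') (simp_all add: I_def)
      moreover have "(\<integral>\<^sup>+t. ennreal (I t) * indicator {0..2*pi} t \<partial>lborel) \<le> S"
        unfolding S_def I_def cis_conv_exp using r by (intro SUP_upper) auto
      ultimately have IA: "integral {0..2*pi} I \<le> A"
        using A by simp
      define G where "G = (\<lambda>t. (1 + I t) * (2 / (1 - cmod z)))"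
      have intG: "(G has_integral (2 * pi + integral {0..2*pi} I) * (2 / (1 - cmod z))) {0..2*pi}"
      proof -
        have "((\<lambda>t. 1) has_integral 2 * pi) {0..2*pi}"
          using has_integral_const_real[of "1::real" 0 "2*pi"] by simp
        then show ?thesis
          unfolding G_def
          using \<open>(I has_integral _) _\<close> by (intro has_integral_mult_left has_integral_add)
      qed
      \<comment> \<open>The Cauchy integrand pulled back along \<open>u = r * cis t\<close>, with
        \<open>du = r * \<i> * cis t dt\<close>; \<open>G\<close> is its majorant.\<close>
      define F where "F = (\<lambda>t. f (of_real r * cis t) ^ N / (of_real r * cis t - z) * r * \<i> * cis t)"
      have "((\<lambda>u. f u ^ N / (u - z)) has_contour_integral 2 * of_real pi * \<i> * f z ^ N) (circlepath 0 r)"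
      proof (rule Cauchy_integral_circlepath_simple)
        show "(\<lambda>u. f u ^ N) holomorphic_on cball 0 r"
          using r by (intro holomorphic_intros holomorphic_on_subset[OF hol]) auto
      qed (use r in auto)
      then have intF: "(F has_integral 2 * of_real pi * \<i> * f z ^ N) {0..2*pi}"
        unfolding circlepath_def F_def
        by (subst (asm) has_contour_integral_part_circlepath_iff) (simp_all)
      have FG: "cmod (F t) \<le> G t" for t
      proof -
        let ?v = "cmod (f (of_real r * cis t))"
        have "?v ^ N \<le> 1 + I t"
        proof (cases "?v \<le> 1")
          case True
          then show ?thesis by (simp add: I_def power_le_one add_increasing2)
        next
          case False
          then have "?v ^ N = ?v powr real N" by (subst powr_realpow) auto
          also have "\<dots> \<le> I t" unfolding I_def using False N by (intro powr_mono) auto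
          finally show ?thesis by simp
        qed
        moreover have "(1 - cmod z) / 2 \<le> cmod (of_real r * cis t - z)"
        proof -
          have "cmod (of_real r * cis t) = r" using r by (simp add: norm_mult)
          then show ?thesis
            using norm_triangle_ineq2[of "of_real r * cis t" z] by (simp add: r_def field_simps)
        qed
        ultimately have "?v ^ N / cmod (of_real r * cis t - z) \<le> (1 + I t) / ((1 - cmod z) / 2)"
          using z by (intro frac_le) (auto simp: I_def)
        moreover have "cmod (F t) = ?v ^ N / cmod (of_real r * cis t - z) * r"
          using r by (simp add: F_def norm_mult norm_divide norm_power)
        moreover have "\<dots> \<le> ?v ^ N / cmod (of_real r * cis t - z)"
          using r by (intro mult_left_le) auto
        ultimately show ?thesis by (simp add: G_def)
      qed
      have "cmod (integral {0..2*pi} F) \<le> integral {0..2*pi} G"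
        using intF intG FG by (intro integral_norm_bound_integral) blast+
      then have "2 * pi * cmod (f z) ^ N \<le> (2 * pi + integral {0..2*pi} I) * (2 / (1 - cmod z))"
        unfolding integral_unique[OF intF] integral_unique[OF intG]
        by (simp add: norm_mult norm_power)
      also have "\<dots> \<le> (2 * pi + A) * (2 / (1 - cmod z))"
        using IA z by (intro mult_right_mono) auto
      finally show ?thesis
        using z by (simp add: field_simps)
    qed
  qed
qed

lemma riemann_mapping_inverse_growth:
  assumes f: "riemann_mapping f D" "f \<in> hardy_space p" and N: "real N \<le> p"
  obtains g M where "g holomorphic_on D" "g ` D \<subseteq> ball 0 1"
    "\<And>w. w \<in> D \<Longrightarrow> cmod w ^ N * (1 - cmod (g w)) \<le> M"
proof -
  obtain M where M: "\<And>z. z \<in> ball 0 1 \<Longrightarrow> cmod (f z) ^ N * (1 - cmod z) \<le> M"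
    using hardy_space_growth[OF f(2) N] by blast
  have inj: "inj_on f (ball 0 1)" and D: "f ` ball 0 1 = D"
    using f(1) by (auto simp: riemann_mapping_def bij_betw_def)
  obtain g where g: "g holomorphic_on D" "\<And>z. z \<in> ball 0 1 \<Longrightarrow> g (f z) = z"
    using holomorphic_has_inverse[OF _ open_ball inj] f(1) D unfolding riemann_mapping_def by metis
  show ?thesis
  proof
    show "g ` D \<subseteq> ball 0 1" using g(2) D by auto
    show "cmod w ^ N * (1 - cmod (g w)) \<le> M" if "w \<in> D" for w
      using that M g(2) D by (metis imageE)
  qed (rule g(1))
qed

section \<open>Topology of comb domains\<close>

definition comb_set :: "(nat \<Rightarrow> real) \<Rightarrow> complex set" where
  "comb_set x = {z. Re z > - x 1} - (\<Union>n. {Complex (x n) y |y. \<bar>y\<bar> \<ge> 1})"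

lemma mem_comb_set: "z \<in> comb_set x \<longleftrightarrow> Re z > - x 1 \<and> (\<forall>n. Re z = x n \<longrightarrow> \<bar>Im z\<bar> < 1)"
  unfolding comb_set_def by (auto simp: complex_eq_iff not_le)

locale spaced =
  fixes x :: "nat \<Rightarrow> real"
  assumes x0: "x 0 = 0" and gap: "x n + 1 \<le> x (Suc n)"
begin

lemma x_strict_mono: "strict_mono x"
  by (rule strict_monoI_Suc) (smt (verit) gap)

lemma x_nonneg: "0 \<le> x n"
  using strict_mono_less_eq[OF x_strict_mono, of 0 n] by (simp add: x0)

lemma x1: "1 \<le> x 1"
  using gap[of 0] by (simp add: x0)

lemma x_ge_n: "real n \<le> x n"
proof (induction n)
  case (Suc n)
  then show ?case using gap[of n] by simp
qed (simp add: x0)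

lemma x_separated: "m \<noteq> n \<Longrightarrow> 1 \<le> \<bar>x m - x n\<bar>"
proof (induction m n rule: linorder_wlog)
  case (le m n)
  then have "x (Suc m) \<le> x n" by (simp add: strict_mono_less_eq[OF x_strict_mono])
  then show ?case using gap[of m] by simp
qed (simp add: abs_minus_commute)

text \<open>An infinite union of closed teeth need not be closed; here it is, because the nodes are
  uniformly separated.\<close>

lemma open_comb_set: "open (comb_set x)"
proof -
  have "closed (range x)"
  proof (rule discrete_imp_closed[of 1])
    show "\<forall>s\<in>range x. \<forall>t\<in>range x. dist t s < 1 \<longrightarrow> t = s"
      using x_separated by (auto simp: dist_real_def) (metis not_le)
  qed simp
  then have "closed (Re -` range x \<inter> {z. 1 \<le> \<bar>Im z\<bar>})"
    by (intro closed_Int closed_vimage closed_Collect_le continuous_intros)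
  moreover have "comb_set x = {z. Re z > - x 1} - (Re -` range x \<inter> {z. 1 \<le> \<bar>Im z\<bar>})"
    by (auto simp: mem_comb_set not_le)
  ultimately show ?thesis
    by (simp add: open_Diff open_halfspace_Re_gt)
qed

text \<open>The domain is first flattened vertically onto its real part, which avoids the teeth
  because \<open>\<bar>Im z\<bar>\<close> only decreases, and the resulting real ray is then shrunk
  to 0.\<close>

lemma contractible_comb_set: "contractible (comb_set x)"
proof -
  have "closed_segment z (of_real (Re z)) \<subseteq> comb_set x" if z: "z \<in> comb_set x" for z
  proof
    fix w assume "w \<in> closed_segment z (of_real (Re z))"
    then obtain u where u: "0 \<le> u" "u \<le> 1" "w = (1 - u) *\<^sub>R z + u *\<^sub>R of_real (Re z)"
      by (auto simp: closed_segment_def)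
    have "Re w = Re z" unfolding u(3) by (simp add: algebra_simps)
    moreover have "\<bar>Im w\<bar> = (1 - u) * \<bar>Im z\<bar>"
      unfolding u(3) using u(1,2) by (simp add: abs_mult)
    moreover have "(1 - u) * \<bar>Im z\<bar> \<le> \<bar>Im z\<bar>"
      using u by (simp add: mult_left_le_one_le)
    ultimately show "w \<in> comb_set x" using z unfolding mem_comb_set by force
  qed
  then have 1: "homotopic_with_canon (\<lambda>_. True) (comb_set x) (comb_set x) id (\<lambda>z. of_real (Re z))"
    by (intro homotopic_with_linear continuous_intros) auto
  have "closed_segment (of_real (Re z)) 0 \<subseteq> comb_set x" if z: "z \<in> comb_set x" for z
  proof
    fix w assume "w \<in> closed_segment (of_real (Re z)) (0::complex)"
    then obtain u where u: "0 \<le> u" "u \<le> 1" "w = (1 - u) *\<^sub>R of_real (Re z)"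
      by (auto simp: closed_segment_def)
    have "Re z > - x 1" using z by (simp add: mem_comb_set)
    then have "(1 - u) * Re z > - x 1"
      using u x1 by (smt (verit) mult_left_le_one_le mult_nonneg_nonneg mult_minus_right)
    then show "w \<in> comb_set x" using u by (simp add: mem_comb_set)
  qed
  then have 2: "homotopic_with_canon (\<lambda>_. True) (comb_set x) (comb_set x) (\<lambda>z. of_real (Re z)) (\<lambda>z. 0)"
    by (intro homotopic_with_linear continuous_intros)
  show ?thesis
    unfolding contractible_def using homotopic_with_trans[OF 1 2] by blast
qed

text \<open>Needed because \<open>hardy_number\<close> chooses its mapping by
  \<open>SOME\<close>.\<close>

lemma ex_riemann_mapping: "\<exists>f. riemann_mapping f (comb_set x)"
proof -
  have "0 \<in> comb_set x" "of_real (- x 1) \<notin> comb_set x"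
    using x1 by (auto simp: mem_comb_set)
  then have "comb_set x \<noteq> {}" "comb_set x \<noteq> UNIV" by auto
  then obtain f g where "g holomorphic_on ball 0 1" "\<forall>z\<in>comb_set x. f z \<in> ball 0 1 \<and> g (f z) = z"
      "\<forall>z\<in>ball 0 1. g z \<in> comb_set x \<and> f (g z) = z"
    using contractible_imp_simply_connected[OF contractible_comb_set]
      simply_connected_eq_biholomorphic_to_disc[OF open_comb_set] by auto
  then have "riemann_mapping g (comb_set x)"
    unfolding riemann_mapping_def by (auto intro!: bij_betwI[where g = f])
  then show ?thesis by blast
qed

lemma ball_subset_comb_set:
  assumes "0 \<le> t"
  shows "ball (of_real t) 1 \<subseteq> comb_set x"
proof
  fix z :: complex assume "z \<in> ball (of_real t) 1"
  then have "cmod (z - of_real t) < 1" by (simp add: dist_norm norm_minus_commute)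
  then have "\<bar>Re z - t\<bar> < 1" "\<bar>Im z\<bar> < 1"
    using abs_Re_le_cmod[of "z - of_real t"] abs_Im_le_cmod[of "z - of_real t"] by auto
  then show "z \<in> comb_set x" using assms x1 by (auto simp: mem_comb_set)
qed

lemma column_ball_subset_comb_set:
  "ball (of_real ((x n + x (Suc n)) / 2)) ((x (Suc n) - x n) / 2) \<subseteq> comb_set x" (is "ball (of_real ?m) ?r \<subseteq> _")
proof
  fix z :: complex assume "z \<in> ball (of_real ?m) ?r"
  then have "cmod (z - of_real ?m) < ?r" by (simp only: dist_norm norm_minus_commute mem_ball)
  moreover have "\<bar>Re z - ?m\<bar> \<le> cmod (z - of_real ?m)"
    using abs_Re_le_cmod[of "z - of_real ?m"] by simp
  ultimately have "x n < Re z" "Re z < x (Suc n)"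
    by (auto simp: abs_if field_simps split: if_splits)
  moreover from this have "Re z \<noteq> x k" for k
    using strict_mono_less[OF x_strict_mono] by (metis not_less_eq order.asym)
  ultimately show "z \<in> comb_set x"
    using x_nonneg[of n] x1 by (auto simp: mem_comb_set)
qed

section \<open>Harnack chains and finiteness of the Hardy number\<close>

text \<open>Each move of length at most 1/2 inside a unit disc costs the Harnack factor (1 + 1/2) /
  (1 - 1/2) = 3.\<close>

lemma Harnack_chain:
  assumes hol: "g holomorphic_on comb_set x" and im: "g ` comb_set x \<subseteq> ball 0 1"
    and t: "0 \<le> t" "t \<le> real k / 2"
  shows "1 - cmod (g 0) \<le> 3 ^ k * (1 - cmod (g (of_real t)))"
  using t
proof (induction k arbitrary: t)
  case 0
  then show ?case by simp
next
  case (Suc k)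
  \<comment> \<open>The maximum keeps the centre on the nonnegative axis, where unit discs are known
    to lie in the domain.\<close>
  define s where "s = max 0 (t - 1/2)"
  have s: "0 \<le> s" "s \<le> real k / 2" "\<bar>t - s\<bar> \<le> 1/2"
    using Suc.prems by (auto simp: s_def max_def field_simps)
  let ?d = "cmod (of_real t - of_real s :: complex)"
  have d: "?d \<le> 1/2" using s(3) by (metis norm_of_real of_real_diff)
  have b: "ball (of_real s) 1 \<subseteq> comb_set x" by (rule ball_subset_comb_set[OF s(1)])
  have im': "cmod (g w) < 1" if "w \<in> comb_set x" for w using im that by auto
  have "of_real s \<in> comb_set x" "of_real t \<in> comb_set x"
    using ball_subset_comb_set[OF s(1)] ball_subset_comb_set[OF Suc.prems(1)]
    by (meson centre_in_ball subsetD zero_less_one)+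
  note pos = this[THEN im']
  have "(1 - cmod (g (of_real s))) * (1 - ?d) \<le> (1 - cmod (g (of_real t))) * (1 + ?d)"
    using d by (intro Harnack_ball(1) holomorphic_on_subset[OF hol b]) (use im b in auto)
  moreover have "(1 - cmod (g (of_real s))) * (1/2) \<le> (1 - cmod (g (of_real s))) * (1 - ?d)"
    using d pos by (intro mult_left_mono) auto
  moreover have "(1 - cmod (g (of_real t))) * (1 + ?d) \<le> (1 - cmod (g (of_real t))) * (3/2)"
    using d pos by (intro mult_left_mono) auto
  ultimately have "1 - cmod (g (of_real s)) \<le> 3 * (1 - cmod (g (of_real t)))" by argo
  then have "3 ^ k * (1 - cmod (g (of_real s))) \<le> 3 ^ k * (3 * (1 - cmod (g (of_real t))))"
    by (intro mult_left_mono) auto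
  then show ?case using Suc.IH[OF s(1,2)] unfolding power_Suc2 mult.assoc by linarith
qed

text \<open>The chain ends at \<open>x n + 1\<close>, at distance 1 from the boundary of the disc
  that fills the column. Harnack from there to the centre therefore costs only one factor of the
  column width.\<close>

lemma Harnack_column:
  assumes hol: "g holomorphic_on comb_set x" and im: "g ` comb_set x \<subseteq> ball 0 1"
    and wide: "2 \<le> x (Suc n) - x n" and k: "x n + 1 \<le> real k / 2"
  shows "1 - cmod (g 0) \<le> 3 ^ k * ((x (Suc n) - x n) * (1 - cmod (g (of_real ((x n + x (Suc n)) / 2)))))"
proof -
  let ?m = "(x n + x (Suc n)) / 2" and ?r = "(x (Suc n) - x n) / 2" and ?s = "x n + 1"
  note b = column_ball_subset_comb_set[of n]
  have d: "cmod (of_real ?s - of_real ?m) = ?r - 1"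
  proof -
    have "cmod (of_real ?s - of_real ?m) = \<bar>?s - ?m\<bar>" by (metis norm_of_real of_real_diff)
    also have "\<dots> = ?r - 1" using wide by (simp add: abs_if field_simps)
    finally show ?thesis .
  qed
  have "of_real ?m \<in> comb_set x" using b wide by (intro subsetD[OF b] centre_in_ball[THEN iffD2]) simp
  then have pos: "0 < 1 - cmod (g (of_real ?m))" using im by auto
  have "(1 - cmod (g (of_real ?s))) * (?r - (?r - 1)) \<le> (1 - cmod (g (of_real ?m))) * (?r + (?r - 1))"
    unfolding d[symmetric]
  proof (rule Harnack_ball(2)[OF holomorphic_on_subset[OF hol b]])
    show "g ` ball (of_real ?m) ?r \<subseteq> ball 0 1" using im b by blast
    show "cmod (of_real ?s - of_real ?m) < ?r" by (simp only: d)
  qed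
  also have "\<dots> \<le> (1 - cmod (g (of_real ?m))) * (x (Suc n) - x n)"
    using pos by (intro mult_left_mono) (auto simp: field_simps)
  finally have "1 - cmod (g (of_real ?s)) \<le> (x (Suc n) - x n) * (1 - cmod (g (of_real ?m)))"
    by (simp add: mult.commute)
  then have "3 ^ k * (1 - cmod (g (of_real ?s))) \<le> 3 ^ k * ((x (Suc n) - x n) * (1 - cmod (g (of_real ?m))))"
    by (intro mult_left_mono) auto
  moreover have "1 - cmod (g 0) \<le> 3 ^ k * (1 - cmod (g (of_real ?s)))"
    using k x_nonneg[of n] by (intro Harnack_chain[OF hol im]) auto
  ultimately show ?thesis by linarith
qed

lemma hardy_number_comb_set_finite:
  assumes L: "L > 0"
    and freq: "\<exists>\<^sub>F n in sequentially. x n \<le> real K * real (Suc n) \<and> exp (L * real n) \<le> x (Suc n) - x n"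
  shows "hardy_number (comb_set x) < \<infinity>"
proof -
  \<comment> \<open>Chosen so that the chain loss \<open>3 ^ (2 * K * n)\<close> equals
    \<open>exp (L * real n) powr c\<close>. The 2 added in \<open>N\<close> pays for the factor
    \<open>d\<close> of the column disc and for one more \<open>d\<close> that beats
    \<open>Q\<close>.\<close>
  define c where "c = 2 * real K * ln 3 / L"
  define N where "N = nat \<lceil>c\<rceil> + 2"
  have Nc: "real N \<ge> c + 2" unfolding N_def by linarith
  have False if f: "riemann_mapping f (comb_set x)" "f \<in> hardy_space p" and p: "real N \<le> p" for f p
  proof -
    obtain g M where hol: "g holomorphic_on comb_set x" and im: "g ` comb_set x \<subseteq> ball 0 1"
      and M: "\<And>w. w \<in> comb_set x \<Longrightarrow> cmod w ^ N * (1 - cmod (g w)) \<le> M"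
      using riemann_mapping_inverse_growth[OF f p] by metis
    have "0 \<in> comb_set x" using x1 by (auto simp: mem_comb_set)
    then have u0: "0 < 1 - cmod (g 0)" using im by auto
    \<comment> \<open>\<open>Q\<close> collects every factor that does not depend on
      \<open>n\<close>.\<close>
    define Q where "Q = M * 2 ^ N * 3 ^ (2 * K + 2) / (1 - cmod (g 0))"
    have lim: "filterlim (\<lambda>n. exp (L * real n)) at_top sequentially"
      using L by (intro filterlim_compose[OF exp_at_top] filterlim_tendsto_pos_mult_at_top[OF tendsto_const])
        (auto simp: filterlim_real_sequentially)
    have "eventually (\<lambda>n. 2 \<le> exp (L * real n) \<and> Q < exp (L * real n)) sequentially"
      using lim by (intro eventually_conj) (simp add: filterlim_at_top, simp add: filterlim_at_top_dense)
    with freq obtain n where n: "x n \<le> real K * real (Suc n)" "exp (L * real n) \<le> x (Suc n) - x n"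
      "2 \<le> exp (L * real n)" "Q < exp (L * real n)"
      by (metis (mono_tags, lifting) frequently_eventually_frequently frequently_ex)
    define d where "d = x (Suc n) - x n"
    have d: "exp (L * real n) \<le> d" "2 \<le> d" "Q < d" using n by (auto simp: d_def)
    define m where "m = (x n + x (Suc n)) / 2"
    \<comment> \<open>Steps of length 1/2 reach \<open>x n + 1\<close> after
      \<open>2 * (x n + 1)\<close> steps, which is at most
      \<open>2 * K * (n + 1) + 2\<close>.\<close>
    let ?u = "1 - cmod (g (of_real m))" and ?k = "2 * K * n + (2 * K + 2)"
    have m_in: "of_real m \<in> comb_set x"
      unfolding m_def using d(2)
      by (intro subsetD[OF column_ball_subset_comb_set[of n]] centre_in_ball[THEN iffD2]) (simp add: d_def)
    have upos: "0 < ?u" using im m_in by auto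
    have m: "d / 2 \<le> m" using x_nonneg[of n] by (simp add: m_def d_def)
    have "(d / 2) ^ N * ?u \<le> cmod (of_real m) ^ N * ?u"
      using m d upos by (intro mult_right_mono power_mono) auto
    also have "\<dots> \<le> M" by (rule M[OF m_in])
    finally have 1: "d ^ N * ?u \<le> M * 2 ^ N" by (simp add: field_simps power_divide)
    have "1 - cmod (g 0) \<le> 3 ^ ?k * (d * ?u)"
      unfolding d_def m_def
      using n(1) d(2) by (intro Harnack_column[OF hol im]) (auto simp: d_def algebra_simps)
    then have "d ^ N * (1 - cmod (g 0)) \<le> d ^ N * (3 ^ ?k * (d * ?u))"
      using d by (intro mult_left_mono) auto
    also have "\<dots> = 3 ^ ?k * d * (d ^ N * ?u)" by (simp add: mult_ac)
    also have "\<dots> \<le> 3 ^ ?k * d * (M * 2 ^ N)"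
      using 1 d by (intro mult_left_mono) auto
    finally have "d ^ N \<le> 3 ^ (2 * K * n) * d * Q"
      using u0 by (simp add: Q_def field_simps power_add)
    moreover have "3 ^ (2 * K * n) \<le> d powr c"
    proof -
      have "(3::real) ^ (2 * K * n) = exp (c * (L * real n))"
        using L by (simp add: c_def powr_realpow[symmetric] powr_def mult_ac)
      also have "\<dots> = exp (L * real n) powr c"
        by (simp add: powr_def)
      also have "\<dots> \<le> d powr c"
        using d L by (intro powr_mono2) (auto simp: c_def)
      finally show ?thesis .
    qed
    \<comment> \<open>No sign is known for \<open>M\<close> in advance; it is read off from the
      growth bound itself.\<close>
    moreover have "Q \<ge> 0"
    proof -
      have "0 \<le> d ^ N * ?u" using d upos by simp
      then have "0 \<le> M * 2 ^ N" using 1 by linarith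
      then show ?thesis using u0 by (simp add: Q_def)
    qed
    ultimately have "d ^ N \<le> d powr c * d * Q"
      using d by (smt (verit) mult_right_mono)
    moreover have "d powr c * d * Q < d powr c * d * d"
      using d by (intro mult_strict_left_mono) auto
    moreover have "d powr c * d * d = d powr (c + 2)"
      using d by (simp add: powr_add powr_realpow power2_eq_square)
    moreover have "d powr (c + 2) \<le> d powr real N"
      using d Nc by (intro powr_mono) auto
    moreover have "d powr real N = d ^ N"
      using d by (simp add: powr_realpow)
    ultimately show False by linarith
  qed
  then have "p \<le> real N" if "riemann_mapping f (comb_set x)" "f \<in> hardy_space p" for f p
    using that by (meson nle_le)
  moreover have "riemann_mapping (SOME f. riemann_mapping f (comb_set x)) (comb_set x)"
    using ex_riemann_mapping by (rule someI_ex)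
  ultimately have "hardy_number (comb_set x) \<le> ereal (real N)"
    unfolding hardy_number_def Let_def by (intro Sup_least) auto
  then show ?thesis
    by (metis PInfty_neq_ereal(1) ereal_infty_less(1) ereal_infty_less_eq(1))
qed

end

section \<open>Construction of the nodes\<close>

text \<open>The test at node \<open>n\<close> decides the gap that follows it, whose permitted width
  is governed by \<open>b (Suc n)\<close>. \<open>K\<close> is a natural number so that it can enter
  the number of discs in a chain.\<close>

fun comb_nodes :: "real \<Rightarrow> nat \<Rightarrow> (nat \<Rightarrow> real) \<Rightarrow> nat \<Rightarrow> real" where
  "comb_nodes a K b 0 = 0"
| "comb_nodes a K b (Suc n) = comb_nodes a K b n
     + (if comb_nodes a K b n \<le> real K * real (Suc n) then exp (b (Suc n)) else a)"

text \<open>Otherwise all gaps from some point on equal \<open>a\<close>, and the nodes, growing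
  with slope \<open>a < K\<close>, fall below the threshold.\<close>

lemma comb_nodes_frequently_large:
  assumes "a < real K"
  shows "\<exists>\<^sub>F n in sequentially. comb_nodes a K b n \<le> real K * real (Suc n)"
proof (rule ccontr)
  assume "\<not> ?thesis"
  then obtain n0 where n0: "\<And>n. n \<ge> n0 \<Longrightarrow> \<not> comb_nodes a K b n \<le> real K * real (Suc n)"
    by (auto simp: not_frequently eventually_sequentially)
  have "comb_nodes a K b (n0 + k) = comb_nodes a K b n0 + a * real k" for k
    proof (induction k)
    case (Suc k)
    then show ?case using n0[of "n0 + k"] by (simp del: of_nat_Suc) (simp add: algebra_simps)
  qed simp
  moreover obtain k where "comb_nodes a K b n0 < real k * (real K - a)"
    using reals_Archimedean3[of "real K - a"] assms by auto
  moreover have "real K * real (Suc (n0 + k)) < comb_nodes a K b (n0 + k)"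
    using n0[of "n0 + k"] by simp
  ultimately have "real K * real (Suc n0) < 0" by (simp add: algebra_simps)
  moreover have "0 \<le> real K * real (Suc n0)" by simp
  ultimately show False by linarith
qed

text \<open>Otherwise some arbitrarily late gap is exponential in \<open>n\<close>, and this gap
  alone, added to a nonnegative node, lifts the next node above its linear threshold.\<close>

lemma comb_nodes_frequently_small:
  assumes "\<delta> > 0" "\<And>n. \<delta> * real n \<le> b (Suc n)" "\<And>n. 0 \<le> comb_nodes a K b n"
  shows "\<exists>\<^sub>F n in sequentially. \<not> comb_nodes a K b n \<le> real K * real (Suc n)"
proof (rule ccontr)
  assume "\<not> ?thesis"
  then have "\<forall>\<^sub>F n in sequentially. comb_nodes a K b n \<le> real K * real (Suc n)"
    by (simp add: not_frequently)
  then have "\<forall>\<^sub>F n in sequentially. comb_nodes a K b n \<le> real K * real (Suc n) \<and>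
      comb_nodes a K b (Suc n) \<le> real K * real (Suc (Suc n))"
    by (intro eventually_conj) (simp_all add: eventually_sequentially_Suc[of "\<lambda>n. comb_nodes a K b n \<le> real K * real (Suc n)"] del: of_nat_Suc comb_nodes.simps)
  moreover have "\<forall>\<^sub>F n in sequentially. real K * real (Suc (Suc n)) < exp (\<delta> * real n)"
    using assms(1) by real_asymp
  ultimately obtain n where n: "comb_nodes a K b n \<le> real K * real (Suc n)"
      "comb_nodes a K b (Suc n) \<le> real K * real (Suc (Suc n))" "real K * real (Suc (Suc n)) < exp (\<delta> * real n)"
    by (metis (mono_tags, lifting) eventually_conj eventually_happens sequentially_bot)
  have "exp (\<delta> * real n) \<le> exp (b (Suc n))" using assms(2) by simp
  also have "\<dots> \<le> comb_nodes a K b (Suc n)" using n(1) assms(3)[of n] by simp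
  finally show False using n by linarith
qed

theorem theorem1p4:
  fixes b :: "nat \<Rightarrow> real"
  assumes "\<And>n. n \<ge> 1 \<Longrightarrow> b n > 0"
    and "mono_on {1..} b"
    and "(INF n\<in>{1<..}. b n - b (n - 1)) > 0"
  shows "\<exists>(x :: nat \<Rightarrow> real) C. comb_domain x C \<and>
     (\<forall>n\<ge>1. x n - x (n - 1) \<le> exp (b n)) \<and>
     liminf (\<lambda>n. ereal (ln (x n - x (n - 1)) / (b n - b (n - 1)))) < \<infinity> \<and>
     hardy_number C < \<infinity>"
proof -
  define \<delta> where "\<delta> = (INF n\<in>{1<..}. b n - b (n - 1))"
  have \<delta>: "\<delta> > 0" using assms(3) by (simp add: \<delta>_def)
  have mono: "b m \<le> b n" if "1 \<le> m" "m \<le> n" for m n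
    using assms(2) that by (auto simp: mono_on_def)
  \<comment> \<open>An infimum in the reals is a lower bound only for a family bounded below;
    monotonicity of \<open>b\<close> supplies the bound 0.\<close>
  have step: "\<delta> \<le> b n - b (n - 1)" if "n > 1" for n
    unfolding \<delta>_def
    by (rule cINF_lower[OF bdd_belowI2[where m = 0]]) (use that mono in auto)
  have lin: "\<delta> * real n \<le> b (Suc n)" for n
  proof (induction n)
    case 0
    then show ?case using assms(1)[of 1] by simp
  next
    case (Suc n)
    then show ?case using step[of "Suc (Suc n)"] by (simp add: algebra_simps)
  qed
  \<comment> \<open>The least of the permitted widths \<open>exp (b n)\<close>, and greater than 1
    because \<open>b 1 > 0\<close>.\<close>
  define a where "a = exp (b 1)"
  define K where "K = nat \<lceil>a\<rceil> + 1"
  have a: "1 < a" "a < real K" using assms(1)[of 1] by (auto simp: a_def K_def, linarith)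
  have ab: "a \<le> exp (b (Suc n))" for n using mono[of 1 "Suc n"] by (simp add: a_def)
  define x where "x = comb_nodes a K b"
  have x_Suc: "x (Suc n) - x n = (if x n \<le> real K * real (Suc n) then exp (b (Suc n)) else a)" for n
    by (simp add: x_def)
  have width: "a \<le> x (Suc n) - x n" "x (Suc n) - x n \<le> exp (b (Suc n))" for n
    using ab[of n] by (auto simp: x_Suc)
  interpret spaced x
  proof
    show "x 0 = 0" by (simp add: x_def)
    show "x n + 1 \<le> x (Suc n)" for n using width(1)[of n] a(1) by linarith
  qed
  have pred: "\<exists>m. n = Suc m" if "n \<ge> 1" for n using that by (cases n) auto
  have "comb_domain x (comb_set x)"
    unfolding comb_domain_def
  proof (intro conjI)
    show "x 0 = 0" by (rule x0)
    show "\<forall>n\<ge>1. x n > 0" using x_ge_n by (smt (verit) of_nat_1 of_nat_le_iff)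
    show "strict_mono_on {1..} x"
      using x_strict_mono by (auto simp: strict_mono_on_def strict_mono_def)
    show "filterlim x at_top sequentially"
      by (rule filterlim_at_top_mono[OF filterlim_real_sequentially]) (simp add: x_ge_n)
    have "a \<le> (INF n\<in>{1..}. x n - x (n - 1))"
    proof (rule cINF_greatest)
      fix n :: nat assume "n \<in> {1..}"
      then obtain m where "n = Suc m" using pred by auto
      then show "a \<le> x n - x (n - 1)" using width(1)[of m] by simp
    qed simp
    then show "1 < (INF n\<in>{1..}. x n - x (n - 1))" using a by simp
    show "open (comb_set x)" by (rule open_comb_set)
    show "connected (comb_set x)"
      using contractible_imp_connected contractible_comb_set by blast
  qed (simp add: comb_set_def)
  moreover have "\<forall>n\<ge>1. x n - x (n - 1) \<le> exp (b n)" using pred width by force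
  moreover have "liminf (\<lambda>n. ereal (ln (x n - x (n - 1)) / (b n - b (n - 1)))) < \<infinity>"
  proof -
    \<comment> \<open>The restriction to \<open>n \<ge> 1\<close> excludes the difference
      \<open>b 1 - b 0\<close>, which \<open>\<delta>\<close> does not control.\<close>
    have "\<exists>\<^sub>F n in sequentially. n \<ge> 1 \<and> \<not> x n \<le> real K * real (Suc n)"
      unfolding x_def using x_nonneg[unfolded x_def]
      by (intro frequently_eventually_conj comb_nodes_frequently_small[OF \<delta> lin] eventually_ge_at_top)
    then have "\<exists>\<^sub>F n in sequentially. ereal (ln (x (Suc n) - x n) / (b (Suc n) - b n)) \<le> ereal (ln a / \<delta>)"
    proof (rule frequently_elim1)
      fix n assume n: "n \<ge> 1 \<and> \<not> x n \<le> real K * real (Suc n)"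
      then have "\<delta> \<le> b (Suc n) - b n" using step[of "Suc n"] by simp
      moreover have "ln (x (Suc n) - x n) = ln a" using n by (simp only: x_Suc if_False)
      ultimately show "ereal (ln (x (Suc n) - x n) / (b (Suc n) - b n)) \<le> ereal (ln a / \<delta>)"
        using a \<delta> by (simp add: frac_le)
    qed
    \<comment> \<open>Index shift back to the form of the statement; a bound that holds infinitely
      often then bounds the lower limit.\<close>
    then have "\<exists>\<^sub>F n in sequentially. ereal (ln (x n - x (n - 1)) / (b n - b (n - 1))) \<le> ereal (ln a / \<delta>)"
      unfolding frequently_def by (subst eventually_sequentially_Suc[symmetric]) simp
    then have "\<not> ereal (ln a / \<delta>) < liminf (\<lambda>n. ereal (ln (x n - x (n - 1)) / (b n - b (n - 1))))"
      by (auto simp: frequently_def not_le dest!: less_LiminfD)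
    then show ?thesis by (metis PInfty_neq_ereal(1) ereal_infty_less(1))
  qed
  moreover have "hardy_number (comb_set x) < \<infinity>"
  proof (rule hardy_number_comb_set_finite[OF \<delta>])
    show "\<exists>\<^sub>F n in sequentially. x n \<le> real K * real (Suc n) \<and> exp (\<delta> * real n) \<le> x (Suc n) - x n"
      using comb_nodes_frequently_large[OF a(2), of b] unfolding x_def[symmetric]
      by (rule frequently_elim1) (use lin in \<open>simp add: x_Suc\<close>)
  qed
  ultimately show ?thesis by blast
qed

end
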